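(* For every planar multigraph $M$ on $n \geq 1$ vertices admitting an embedding into the plane without $2$-faces, $a(M) \geq \frac{n}{4}+\frac{3}{10}$.
   Context: Multigraphs are finite, may have parallel edges, but have no loops. For a multigraph $M$, $a(M)$ denotes the maximum number of vertices of an induced forest in $M$ (a $2$-cycle formed by two parallel edges counts as a cycle). In a plane embedding, each edge is considered to have two sides; the degree of a face $f$ is the number of incidences between $f$ and sides of edges (an edge with the same face on both sides contributes $2$). A $2$-face is a face of degree $2$. *)

theory Defs
  imports "HOL-Analysis.Analysis"
begin


record ('v, 'e) pre_multigraph =
  verts :: "'v set"
  edges :: "'e set"
  ends :: "'e \<Rightarrow> 'v set"

text \<open>Parallel edges are distinct edges with the same set of ends; loops are excluded because
  every edge has exactly two ends.\<close>

locale multigraph =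
  fixes M :: "('v, 'e) pre_multigraph"
  assumes finite_verts: "finite (verts M)"
    and finite_edges: "finite (edges M)"
    and ends_subset: "e \<in> edges M \<Longrightarrow> ends M e \<subseteq> verts M"
    and card_ends: "e \<in> edges M \<Longrightarrow> card (ends M e) = 2"

definition induced :: "('v, 'e) pre_multigraph \<Rightarrow> 'v set \<Rightarrow> ('v, 'e) pre_multigraph" where
  "induced M S = \<lparr>verts = S, edges = {e \<in> edges M. ends M e \<subseteq> S}, ends = ends M\<rparr>"

text \<open>The edge \<open>es ! i\<close> joins \<open>vs ! i\<close> to its cyclic successor. Length 2 is allowed, and then
  \<open>distinct es\<close> says that the two edges are parallel.\<close>

definition is_cycle :: "('v, 'e) pre_multigraph \<Rightarrow> 'v list \<Rightarrow> 'e list \<Rightarrow> bool" where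
  "is_cycle M vs es \<longleftrightarrow>
     2 \<le> length vs \<and> length es = length vs \<and> distinct vs \<and> distinct es \<and>
     set vs \<subseteq> verts M \<and> set es \<subseteq> edges M \<and>
     (\<forall>i<length vs. ends M (es ! i) = {vs ! i, vs ! (Suc i mod length vs)})"

definition forest :: "('v, 'e) pre_multigraph \<Rightarrow> bool" where
  "forest M \<longleftrightarrow> (\<nexists>vs es. is_cycle M vs es)"

definition max_induced_forest :: "('v, 'e) pre_multigraph \<Rightarrow> nat" where
  "max_induced_forest M = Max {card S | S. S \<subseteq> verts M \<and> forest (induced M S)}"



text \<open>The plane is \<^typ>\<open>complex\<close>. A vertex \<open>v\<close> is drawn as the point \<open>p v\<close> and an edge \<open>e\<close> as
  the (closed) arc \<open>g e\<close>, which meets other edges and the vertices only as prescribed by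
  the ends of \<open>e\<close>.\<close>

definition plane_embedding ::
  "('v, 'e) pre_multigraph \<Rightarrow> ('v \<Rightarrow> complex) \<Rightarrow> ('e \<Rightarrow> real \<Rightarrow> complex) \<Rightarrow> bool" where
  "plane_embedding M p g \<longleftrightarrow>
     inj_on p (verts M) \<and>
     (\<forall>e\<in>edges M. arc (g e) \<and> {pathstart (g e), pathfinish (g e)} = p ` ends M e \<and>
        path_image (g e) \<inter> p ` verts M = p ` ends M e) \<and>
     (\<forall>e\<in>edges M. \<forall>e'\<in>edges M. e \<noteq> e' \<longrightarrow>
        path_image (g e) \<inter> path_image (g e') \<subseteq> p ` verts M)"

definition drawing ::
  "('v, 'e) pre_multigraph \<Rightarrow> ('v \<Rightarrow> complex) \<Rightarrow> ('e \<Rightarrow> real \<Rightarrow> complex) \<Rightarrow> complex set" where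
  "drawing M p g = p ` verts M \<union> (\<Union>e\<in>edges M. path_image (g e))"

definition faces ::
  "('v, 'e) pre_multigraph \<Rightarrow> ('v \<Rightarrow> complex) \<Rightarrow> ('e \<Rightarrow> real \<Rightarrow> complex) \<Rightarrow> complex set set" where
  "faces M p g = components (- drawing M p g)"

text \<open>The number of sides of \<open>e\<close> at which the face \<open>F\<close> lies. An edge on the boundary of \<open>F\<close> has
  \<open>F\<close> on both of its sides iff it is not on the boundary of any other face.\<close>

definition side_incidences ::
  "('v, 'e) pre_multigraph \<Rightarrow> ('v \<Rightarrow> complex) \<Rightarrow> ('e \<Rightarrow> real \<Rightarrow> complex) \<Rightarrow>
     complex set \<Rightarrow> 'e \<Rightarrow> nat" where
  "side_incidences M p g F e =
     (if \<not> path_image (g e) \<subseteq> frontier F then 0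
      else if \<exists>F'\<in>faces M p g. F' \<noteq> F \<and> path_image (g e) \<subseteq> frontier F' then 1
      else 2)"

definition face_degree ::
  "('v, 'e) pre_multigraph \<Rightarrow> ('v \<Rightarrow> complex) \<Rightarrow> ('e \<Rightarrow> real \<Rightarrow> complex) \<Rightarrow>
     complex set \<Rightarrow> nat" where
  "face_degree M p g F = (\<Sum>e\<in>edges M. side_incidences M p g F e)"

end

theory Submission
  imports Defs
begin

text \<open>Let \<open>n\<close> and \<open>e\<close> be the numbers of vertices and edges. Order the vertices at random and keep
  a vertex if among its neighbours that precede it there is none joined to it by parallel edges
  and at most one joined by a single edge. The kept vertices induce a forest. A vertex with \<open>r\<close>
  neighbours of the first kind and \<open>b\<close> of the second is kept with probability
  \<open>(r + 2b) / ((r + b) (r + b + 1))\<close>, which is at least \<open>1/2 - (2r + b) / 24\<close>. Hence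
  \<open>a(M) \<ge> n/2 - e/12\<close>.

  If there is an edge, then without \<open>2\<close>-faces every face has degree at least \<open>3\<close>, so Euler's formula
  gives \<open>e \<le> 3n - 6\<close> and \<open>a(M) \<ge> n/4 + 1/2\<close>. The number of faces is controlled by adding the edges one
  by one: an arc joining two points of one component of the drawing splits one face into two,
  and any other arc leaves the number of faces unchanged.\<close>

section \<open>Adding an arc to a compact plane set\<close>

text \<open>An arc is homeomorphic to an interval, so a nonempty interior would embed into the real
  line, against invariance of dimension.\<close>

lemma interior_arc_image_empty:
  fixes g :: "real \<Rightarrow> 'a::euclidean_space"
  assumes "arc g" "2 \<le> DIM('a)"
  shows "interior (path_image g) = {}"
proof (rule ccontr)
  assume ne: "interior (path_image g) \<noteq> {}"
  obtain h k where "homeomorphism (path_image g) {0..1::real} h k"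
    using homeomorphic_arc_image_interval[OF assms(1), of 0 1] by (auto simp: homeomorphic_def)
  then have "continuous_on (interior (path_image g)) h" "inj_on h (interior (path_image g))"
    using interior_subset by (auto simp: homeomorphism_def intro: continuous_on_subset inj_on_inverseI[of _ k])
  then have "DIM('a) \<le> DIM(real)" using invariance_of_dimension[of "interior (path_image g)" h] ne by auto
  then show False using assms(2) by simp
qed

text \<open>The components of an open set are its only partition into nonempty connected open sets.
  Deleting \<open>X\<close> changes only the block \<open>F0\<close>, so a partition of
  \<open>F0 - X\<close> of this kind completes the list.\<close>

lemma components_refine:
  fixes S :: "'a::real_normed_vector set"
  assumes S: "open S" and F0: "F0 \<in> components S" and P: "pairwise disjnt P" "\<Union>P = F0 - X"
    and P': "\<And>F. F \<in> P \<Longrightarrow> open F \<and> connected F \<and> F \<noteq> {}" and X: "X \<subseteq> F0"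
  shows "components (S - X) = components S - {F0} \<union> P"
proof (rule components_open_unique)
  show "pairwise disjnt (components S - {F0} \<union> P)"
  proof (rule pairwiseI)
    fix A B assume AB: "A \<in> components S - {F0} \<union> P" "B \<in> components S - {F0} \<union> P" "A \<noteq> B"
    have d: "disjnt C D" if "C \<in> components S - {F0}" "D \<in> P" for C D
    proof -
      have "C \<inter> F0 = {}" using that F0 components_eq[of C S F0] by auto
      then show ?thesis using that P(2) by (auto simp: disjnt_def)
    qed
    have e: "disjnt C D" if "C \<in> components S" "D \<in> components S" "C \<noteq> D" for C D
      using that components_eq by (auto simp: disjnt_def)
    show "disjnt A B"
      using AB d e P(1) by (metis DiffD1 UnE disjnt_sym pairwiseD)
  qed
  have "\<Union>(components S - {F0}) = S - F0"
    using in_components_unions_complement[OF F0] by simp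
  then show "\<Union> (components S - {F0} \<union> P) = S - X"
    using P(2) X in_components_subset[OF F0] by auto
  show "open F \<and> connected F \<and> F \<noteq> {}" if "F \<in> components S - {F0} \<union> P" for F
    using that P' S open_components in_components_connected in_components_nonempty by blast
qed

text \<open>A connected set with more than one point is perfect, and deleting two points destroys no
  limit point. This extends frontier statements from the inside of an arc to its ends.\<close>

lemma arc_subset_closure_endless:
  fixes g :: "real \<Rightarrow> 'a::{real_normed_vector}"
  assumes "arc g"
  shows "path_image g \<subseteq> closure (path_image g - {pathstart g, pathfinish g})"
proof
  fix x assume x: "x \<in> path_image g"
  have "connected (path_image g)" using assms by (simp add: connected_arc_image)
  moreover have "\<nexists>a. path_image g = {a}"
    using arc_distinct_ends[OF assms] pathstart_in_path_image[of g] pathfinish_in_path_image[of g] by auto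
  ultimately have "x islimpt path_image g" using x connected_imp_perfect by blast
  then have "x islimpt (path_image g - {pathstart g, pathfinish g}) \<union> {pathstart g, pathfinish g}"
    by (rule islimpt_subset) auto
  then have "x islimpt (path_image g - {pathstart g, pathfinish g})"
    using islimpt_Un_finite[of "{pathstart g, pathfinish g}" x "path_image g - {pathstart g, pathfinish g}"]
    by (simp only: Un_commute finite.intros)
  then show "x \<in> closure (path_image g - {pathstart g, pathfinish g})" by (simp add: closure_def)
qed

lemma arc_endless_in_component:
  fixes g :: "real \<Rightarrow> 'a::real_normed_vector"
  assumes "arc g" "path_image g \<inter> D \<subseteq> {pathstart g, pathfinish g}"
  obtains F0 where "F0 \<in> components (- D)" "path_image g - {pathstart g, pathfinish g} \<subseteq> F0"
proof -
  let ?X = "path_image g - {pathstart g, pathfinish g}"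
  have s: "simple_path g" using assms by (simp add: arc_imp_simple_path)
  obtain x where x: "x \<in> ?X" using nonempty_simple_path_endless[OF s] by blast
  have "connected ?X" using connected_simple_path_endless[OF s] .
  moreover have "?X \<subseteq> - D" using assms by auto
  ultimately have "?X \<subseteq> connected_component_set (- D) x" using x by (intro connected_component_maximal)
  moreover have "connected_component_set (- D) x \<in> components (- D)"
    using x \<open>?X \<subseteq> - D\<close> by (intro componentsI) blast
  ultimately show thesis using that by blast
qed

text \<open>The Jordan curve through the chord and an arc of \<open>D\<close> meets \<open>D\<close> in a connected set, so by
  Janiszewski's theorem its two sides cut the component containing the chord into exactly two.\<close>

lemma components_add_chord:
  fixes D :: "complex set"
  assumes D: "compact D" and g: "arc g" "path_image g \<inter> D = {pathstart g, pathfinish g}"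
    and pc: "path_component D (pathstart g) (pathfinish g)"
  obtains F0 P where "F0 \<in> components (- D)" "path_image g - {pathstart g, pathfinish g} \<subseteq> F0"
    "components (- (D \<union> path_image g)) = components (- D) - {F0} \<union> P"
    "card P = 2" "P \<inter> components (- D) = {}" "\<forall>F\<in>P. path_image g \<subseteq> frontier F"
proof -
  let ?A = "path_image g" let ?ends = "{pathstart g, pathfinish g}" let ?X = "?A - ?ends"
  obtain F0 where F0: "F0 \<in> components (- D)" "?X \<subseteq> F0"
    using arc_endless_in_component[of g D] g by blast
  have opD: "open (- D)" using D compact_imp_closed by blast
  have opF0: "open F0" using F0 opD open_components by blast
  have F0D: "F0 \<inter> D = {}" using in_components_subset[OF F0(1)] by blast
  have "path_component D (pathfinish g) (pathstart g)" using pc path_component_sym by blast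
  moreover have "pathfinish g \<noteq> pathstart g" using arc_distinct_ends[OF g(1)] by simp
  ultimately have "path_connected (path_component_set D (pathfinish g))"
    "pathfinish g \<in> path_component_set D (pathfinish g)" "pathstart g \<in> path_component_set D (pathfinish g)"
    using path_component_mem(1)[of D "pathfinish g"] path_component_refl[of "pathfinish g" D] by auto
  \<comment> \<open>An arc back to the start of \<open>g\<close> within \<open>D\<close>. It closes
    \<open>g\<close> to a simple closed curve that meets \<open>D\<close> exactly in the connected
    set \<open>q\<close>, as Janiszewski's theorem requires.\<close>
  then obtain q where q: "arc q" "path_image q \<subseteq> path_component_set D (pathfinish g)"
     "pathstart q = pathfinish g" "pathfinish q = pathstart g"
    using \<open>pathfinish g \<noteq> pathstart g\<close> unfolding path_connected_arcwise by metis
  have qD: "path_image q \<subseteq> D" using q(2) path_component_subset by blast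
  define c where "c = g +++ q"
  have sc: "simple_path c" unfolding c_def
    using g q qD by (intro simple_path_join_loop) auto
  have lc: "pathfinish c = pathstart c" by (simp add: c_def q)
  have pic: "path_image c = ?A \<union> path_image q" by (simp add: c_def q path_image_join)
  obtain I O' where IO: "I \<noteq> {}" "open I" "connected I" "O' \<noteq> {}" "open O'" "connected O'"
     "I \<inter> O' = {}" "I \<union> O' = - path_image c" "frontier I = path_image c" "frontier O' = path_image c"
    using Jordan_curve[OF sc lc] by metis
  have "?A \<inter> path_image q = ?ends"
    using g q qD pathstart_in_path_image[of q] pathfinish_in_path_image[of q] by fastforce
  then have cD: "path_image c \<inter> D = path_image q" using pic qD g q by auto
  have Xne: "?X \<noteq> {}" using g arc_imp_simple_path nonempty_simple_path_endless by blast
  have F0c: "F0 \<inter> path_image c = ?X" using pic qD F0(2) F0D g by auto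
  have conn: "connected (F0 \<inter> C)" if C: "connected C" "C \<inter> path_image c = {}"
      and "open C" and CC: "C = I \<or> C = O'" for C
    unfolding connected_iff_connected_component
  proof (intro ballI)
    fix y z assume yz: "y \<in> F0 \<inter> C" "z \<in> F0 \<inter> C"
    have "connected_component (- (path_image c \<union> D)) y z"
    proof (rule Janiszewski)
      show "compact (path_image c)" using sc by (simp add: compact_simple_path_image)
      show "closed D" using D compact_imp_closed by blast
      show "connected (path_image c \<inter> D)" using cD q by (simp add: connected_arc_image)
      show "connected_component (- path_image c) y z"
        unfolding connected_component_def using C yz by (intro exI[of _ C]) auto
      show "connected_component (- D) y z"
        unfolding connected_component_def using F0D yz in_components_connected[OF F0(1)]
        by (intro exI[of _ F0]) auto
    qed
    then obtain T where T: "connected T" "T \<subseteq> - (path_image c \<union> D)" "y \<in> T" "z \<in> T"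
      unfolding connected_component_def by blast
    have "T \<subseteq> F0" using T yz components_maximal[OF F0(1), of T] by auto
    \<comment> \<open>The frontier of \<open>C\<close> is the curve, which \<open>T\<close> avoids,
      so \<open>T\<close> cannot leave \<open>C\<close>.\<close>
    moreover have "T \<subseteq> C"
    proof (rule ccontr)
      assume "\<not> T \<subseteq> C"
      then have "T \<inter> frontier C \<noteq> {}" using connected_Int_frontier[OF T(1), of C] T yz by blast
      then show False using T CC IO by auto
    qed
    ultimately show "connected_component (F0 \<inter> C) y z"
      unfolding connected_component_def using T by blast
  qed
  \<comment> \<open>Inside the open set \<open>F0\<close>, the sets \<open>C\<close> and
    \<open>F0 \<inter> C\<close> have the same limit points. The ends of the arc follow by taking
    closures.\<close>
  have cl: "?X \<subseteq> closure (F0 \<inter> C)" if "frontier C = path_image c" for C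
  proof -
    have "?X \<subseteq> F0 \<inter> closure C" using that F0(2) pic by (auto simp: frontier_def)
    then show ?thesis using open_Int_closure_subset[OF opF0] by blast
  qed
  have fr: "?A \<subseteq> frontier (F0 \<inter> C)" if "frontier C = path_image c" "open C" for C
  proof -
    have "?A \<subseteq> closure ?X" using arc_subset_closure_endless[OF g(1)] .
    also have "\<dots> \<subseteq> closure (F0 \<inter> C)" using cl[OF that(1)] closure_minimal closed_closure by blast
    finally show ?thesis 
      using that pic opF0 by (auto simp: frontier_def interior_open)
  qed
  let ?P = "{F0 \<inter> I, F0 \<inter> O'}"
  have ne: "F0 \<inter> I \<noteq> {}" "F0 \<inter> O' \<noteq> {}" using cl[OF IO(9)] cl[OF IO(10)] Xne by fastforce+
  have comp: "components (- D - ?X) = components (- D) - {F0} \<union> ?P"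
  proof (rule components_refine[OF opD F0(1) _ _ _ F0(2)])
    show "pairwise disjnt ?P" using IO by (auto simp: pairwise_def disjnt_def)
    show "\<Union>?P = F0 - ?X" using F0c IO by auto
    show "open F \<and> connected F \<and> F \<noteq> {}" if "F \<in> ?P" for F
      using that conn[of I] conn[of O'] ne IO opF0 by auto
  qed
  have "- D - ?X = - (D \<union> ?A)" using g by auto
  moreover have "card ?P = 2" using ne IO by (subst card_2_iff) blast
  \<comment> \<open>A piece that was already a component would be all of \<open>F0\<close>, but
    \<open>F0\<close> contains the inside of the chord and the piece does not.\<close>
  moreover have "?P \<inter> components (- D) = {}"
  proof -
    have "F0 \<inter> C \<notin> components (-D)" if "F0 \<inter> C \<noteq> {}" "C \<inter> path_image c = {}" for C
    proof
      assume "F0 \<inter> C \<in> components (-D)"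
      then have "F0 \<inter> C = F0" using components_eq[of "F0 \<inter> C" "-D" F0] F0(1) that by auto
      then show False using that F0c Xne by auto
    qed
    then show ?thesis using ne IO by auto
  qed
  moreover have "?A \<subseteq> frontier F" if "F \<in> ?P" for F using that fr IO by blast
  ultimately show thesis using that[of F0 ?P] F0 comp by simp
qed

text \<open>Neither the arc nor \<open>D\<close> separates points of one component of \<open>- D\<close>, and the arc meets each
  of the two parts of \<open>D\<close> in one point, so Janiszewski's theorem applies twice.\<close>

lemma components_add_bridge:
  fixes D :: "complex set"
  assumes K: "compact K1" "compact K2" "K1 \<inter> K2 = {}" and g: "arc g"
    and a: "path_image g \<inter> K1 = {pathstart g}" and b: "path_image g \<inter> K2 = {pathfinish g}"
  defines "D \<equiv> K1 \<union> K2"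
  obtains F0 P where "F0 \<in> components (- D)" "path_image g - {pathstart g, pathfinish g} \<subseteq> F0"
    "components (- (D \<union> path_image g)) = components (- D) - {F0} \<union> P"
    "card P = 1" "P \<inter> components (- D) = {}" "\<forall>F\<in>P. path_image g \<subseteq> frontier F"
proof -
  let ?A = "path_image g" let ?ends = "{pathstart g, pathfinish g}" let ?X = "?A - ?ends"
  have AD: "?A \<inter> D = ?ends" using a b by (auto simp: D_def)
  have D: "compact D" using K by (simp add: D_def compact_Un)
  obtain F0 where F0: "F0 \<in> components (- D)" "?X \<subseteq> F0"
    using arc_endless_in_component[of g D] g AD by blast
  have opD: "open (- D)" using D compact_imp_closed by blast
  have opF0: "open F0" using F0 opD open_components by blast
  have F0D: "F0 \<inter> D = {}" using in_components_subset[OF F0(1)] by blast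
  have Xne: "?X \<noteq> {}" using g arc_imp_simple_path nonempty_simple_path_endless by blast
  have int: "interior ?A = {}" using interior_arc_image_empty[OF g] by simp
  have cA: "compact ?A" "closed ?A" using g by (auto simp: compact_arc_image closed_arc_image)
  have F0X: "F0 - ?X = F0 - ?A" using AD F0D by auto
  \<comment> \<open>The arc has empty interior, so even its points in \<open>F0\<close> are limits
    of points of \<open>F0\<close> off the arc. This puts the arc on the frontier of the remaining
    face.\<close>
  have dense: "F0 \<subseteq> closure (F0 - ?A)"
  proof -
    have "closure (- ?A) = UNIV" using int by (simp add: closure_complement)
    then have "F0 \<subseteq> closure (F0 \<inter> - ?A)" using open_Int_closure_subset[OF opF0, of "- ?A"] by simp
    then show ?thesis by (simp add: Diff_eq)
  qed
  have conn: "connected (F0 - ?A)"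
    unfolding connected_iff_connected_component
  proof (intro ballI)
    fix y z assume yz: "y \<in> F0 - ?A" "z \<in> F0 - ?A"
    have cc: "connected_component (- K) y z" if "K \<subseteq> D" for K
      unfolding connected_component_def using F0 yz in_components_connected in_components_subset that
      by (intro exI[of _ F0]) blast
    have "connected_component (- ?A) y z"
      unfolding connected_component_def using yz connected_arc_complement[OF g]
      by (intro exI[of _ "- ?A"]) auto
    then have "connected_component (- (?A \<union> K1)) y z"
      using cc[of K1] K cA a by (rule_tac Janiszewski) (auto simp: D_def compact_imp_closed)
    \<comment> \<open>As \<open>K1\<close> and \<open>K2\<close> are disjoint, this intersection is
      the single point \<open>pathfinish g\<close>.\<close>
    moreover have "connected ((?A \<union> K1) \<inter> K2)" using K b by (simp add: Int_Un_distrib2)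
    ultimately have "connected_component (- ((?A \<union> K1) \<union> K2)) y z"
      using cc[of K2] K cA by (rule_tac Janiszewski) (simp_all add: D_def compact_imp_closed compact_Un del: Compl_Un)
    then obtain T where T: "connected T" "T \<subseteq> - (D \<union> ?A)" "y \<in> T" "z \<in> T"
      unfolding connected_component_def D_def by (metis Un_assoc Un_commute)
    have "T \<subseteq> F0" using T F0(1) yz components_maximal[OF F0(1), of T] by auto
    then show "connected_component (F0 - ?A) y z"
      unfolding connected_component_def using T by blast
  qed
  have fr: "?A \<subseteq> frontier (F0 - ?A)"
  proof -
    have "?A \<subseteq> closure ?X" using arc_subset_closure_endless[OF g] .
    also have "\<dots> \<subseteq> closure (F0 - ?A)" using dense F0(2) closure_minimal closed_closure by blast
    finally show ?thesis using interior_subset by (fastforce simp: frontier_def)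
  qed
  have ne: "F0 - ?A \<noteq> {}" using dense in_components_nonempty[OF F0(1)] by fastforce
  have comp: "components (- D - ?X) = components (- D) - {F0} \<union> {F0 - ?A}"
  proof (rule components_refine[OF opD F0(1) _ _ _ F0(2)])
    show "open F \<and> connected F \<and> F \<noteq> {}" if "F \<in> {F0 - ?A}" for F
      using that conn ne opF0 cA by (auto intro: open_Diff)
  qed (use F0X in auto)
  have "- D - ?X = - (D \<union> ?A)" using AD by auto
  moreover have "{F0 - ?A} \<inter> components (- D) = {}"
    using components_eq[of "F0 - ?A" "-D" F0] F0 ne Xne by auto
  ultimately show thesis using that[of F0 "{F0 - ?A}"] F0 comp fr by simp
qed

section \<open>Euler's formula and face degrees\<close>

text \<open>Each piece is path connected, so it lies inside the path component or misses it. Both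
  sets are therefore finite unions of compact pieces. They serve as the two sides of a
  bridge.\<close>

lemma compact_path_component_finite_Union:
  fixes D :: "'a::t2_space set"
  assumes A: "finite A" "\<And>B. B \<in> A \<Longrightarrow> compact B \<and> path_connected B" "D = \<Union>A"
  shows "compact (path_component_set D x)" "compact (D - path_component_set D x)"
proof -
  let ?C = "path_component_set D x"
  have sub: "B \<subseteq> ?C" if B: "B \<in> A" "B \<inter> ?C \<noteq> {}" for B
  proof -
    obtain y where y: "y \<in> B" "y \<in> ?C" using B by blast
    have "B \<subseteq> path_component_set D y" using y B A by (intro path_component_maximal) auto
    also have "\<dots> = ?C" using path_component_eq[OF y(2)] by simp
    finally show ?thesis by simp
  qed
  have CD: "?C \<subseteq> D" by (rule path_component_subset)
  have "?C = \<Union>{B\<in>A. B \<inter> ?C \<noteq> {}}"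
  proof
    show "?C \<subseteq> \<Union>{B\<in>A. B \<inter> ?C \<noteq> {}}"
    proof
      fix y assume y: "y \<in> ?C"
      then have "y \<in> \<Union>A" using CD A(3) by blast
      then obtain B where "B \<in> A" "y \<in> B" by blast
      then show "y \<in> \<Union>{B\<in>A. B \<inter> ?C \<noteq> {}}" using y by blast
    qed
    show "\<Union>{B\<in>A. B \<inter> ?C \<noteq> {}} \<subseteq> ?C" using sub by blast
  qed
  moreover have "compact (\<Union>{B\<in>A. B \<inter> ?C \<noteq> {}})"
    using A by (intro compact_Union) auto
  ultimately show "compact ?C" by simp
  have "D - ?C = \<Union>{B\<in>A. B \<inter> ?C = {}}"
  proof
    show "D - ?C \<subseteq> \<Union>{B\<in>A. B \<inter> ?C = {}}"
    proof
      fix y assume y: "y \<in> D - ?C"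
      then have "y \<in> \<Union>A" using A(3) by blast
      then obtain B where "B \<in> A" "y \<in> B" by blast
      then show "y \<in> \<Union>{B\<in>A. B \<inter> ?C = {}}" using y sub by blast
    qed
    show "\<Union>{B\<in>A. B \<inter> ?C = {}} \<subseteq> D - ?C" using A(3) by blast
  qed
  moreover have "compact (\<Union>{B\<in>A. B \<inter> ?C = {}})"
    using A by (intro compact_Union) auto
  ultimately show "compact (D - ?C)" by simp
qed

section \<open>Drawings built up edge by edge, and Euler's formula\<close>

locale plane_multigraph = multigraph M for M :: "('v, 'e) pre_multigraph" +
  fixes p :: "'v \<Rightarrow> complex" and g :: "'e \<Rightarrow> real \<Rightarrow> complex"
  assumes embedding: "plane_embedding M p g"
begin

text \<open>All vertices are present from the start, so a new edge always meets the drawing in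
  exactly its two ends.\<close>

definition partial_drawing :: "'e set \<Rightarrow> complex set" where
  "partial_drawing E = p ` verts M \<union> (\<Union>e\<in>E. path_image (g e))"

lemma partial_drawing_insert:
  "partial_drawing (insert e E) = partial_drawing E \<union> path_image (g e)"
  by (auto simp: partial_drawing_def)

lemma faces_eq: "faces M p g = components (- partial_drawing (edges M))"
  by (simp add: faces_def drawing_def partial_drawing_def)

lemma arc_edge: "e \<in> edges M \<Longrightarrow> arc (g e)"
  using embedding by (simp add: plane_embedding_def)

lemma edge_ends: "e \<in> edges M \<Longrightarrow> {pathstart (g e), pathfinish (g e)} = p ` ends M e"
  using embedding by (simp add: plane_embedding_def)

lemma edge_Int_partial_drawing:
  assumes "e \<in> edges M" "E \<subseteq> edges M - {e}"
  shows "path_image (g e) \<inter> partial_drawing E = {pathstart (g e), pathfinish (g e)}"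
proof -
  have "path_image (g e) \<inter> path_image (g e') \<subseteq> p ` verts M" if "e' \<in> E" for e'
  proof -
    have "e' \<in> edges M" "e \<noteq> e'" using that assms(2) by auto
    then show ?thesis using assms(1) embedding unfolding plane_embedding_def by blast
  qed
  then have "path_image (g e) \<inter> partial_drawing E = path_image (g e) \<inter> p ` verts M"
    by (auto simp: partial_drawing_def)
  then show ?thesis using embedding assms(1) by (simp add: plane_embedding_def)
qed

lemma compact_partial_drawing:
  assumes "E \<subseteq> edges M"
  shows "compact (partial_drawing E)"
  unfolding partial_drawing_def using assms finite_edges finite_verts
  by (intro compact_Un compact_UN) (auto intro: finite_imp_compact finite_subset compact_arc_image arc_edge)

lemma compact_path_component_partial_drawing:
  assumes "E \<subseteq> edges M"
  shows "compact (path_component_set (partial_drawing E) x)"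
    "compact (partial_drawing E - path_component_set (partial_drawing E) x)"
proof -
  let ?A = "(\<lambda>v. {p v}) ` verts M \<union> (\<lambda>e. path_image (g e)) ` E"
  have "finite ?A" using assms finite_edges finite_verts finite_subset by blast
  moreover have "compact B \<and> path_connected B" if "B \<in> ?A" for B
    using that assms by (auto intro!: compact_arc_image path_connected_path_image arc_imp_path arc_edge)
  moreover have "partial_drawing E = \<Union>?A" by (auto simp: partial_drawing_def)
  ultimately show "compact (path_component_set (partial_drawing E) x)"
    "compact (partial_drawing E - path_component_set (partial_drawing E) x)"
    using compact_path_component_finite_Union by metis+
qed

text \<open>If the ends lie in one path component, the edge is a chord. Otherwise it is a bridge
  between the path component of its start and the rest of the drawing, both compact.\<close>

lemma components_add_edge:
  assumes e: "e \<in> edges M" and E: "E \<subseteq> edges M - {e}"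
  obtains F0 P where "F0 \<in> components (- partial_drawing E)"
    "path_image (g e) - {pathstart (g e), pathfinish (g e)} \<subseteq> F0"
    "components (- partial_drawing (insert e E)) = components (- partial_drawing E) - {F0} \<union> P"
    "card P = (if path_component (partial_drawing E) (pathstart (g e)) (pathfinish (g e)) then 2 else 1)"
    "P \<inter> components (- partial_drawing E) = {}" "\<forall>F\<in>P. path_image (g e) \<subseteq> frontier F"
proof (cases "path_component (partial_drawing E) (pathstart (g e)) (pathfinish (g e))")
  case True
  have "compact (partial_drawing E)" using E compact_partial_drawing by blast
  then obtain F0 P where "F0 \<in> components (- partial_drawing E)"
    "path_image (g e) - {pathstart (g e), pathfinish (g e)} \<subseteq> F0"
    "components (- (partial_drawing E \<union> path_image (g e))) = components (- partial_drawing E) - {F0} \<union> P"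
    "card P = 2"
    "P \<inter> components (- partial_drawing E) = {}" "\<forall>F\<in>P. path_image (g e) \<subseteq> frontier F"
    by (rule components_add_chord[OF _ arc_edge[OF e] edge_Int_partial_drawing[OF e E] True])
  then show thesis using that[of F0 P] True by (simp add: partial_drawing_insert)
next
  case False
  define K1 where "K1 = path_component_set (partial_drawing E) (pathstart (g e))"
  define K2 where "K2 = partial_drawing E - K1"
  have K: "compact K1" "compact K2" "K1 \<inter> K2 = {}"
    using compact_path_component_partial_drawing[of E] E by (auto simp: K1_def K2_def)
  have D: "K1 \<union> K2 = partial_drawing E" using path_component_subset[of "partial_drawing E"]
    by (auto simp: K1_def K2_def)
  have I: "path_image (g e) \<inter> partial_drawing E = {pathstart (g e), pathfinish (g e)}"
    using edge_Int_partial_drawing[OF e E] .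
  then have "pathstart (g e) \<in> K1" "pathfinish (g e) \<notin> K1"
    using False by (auto simp: K1_def path_component_refl_eq)
  then have "path_image (g e) \<inter> K1 = {pathstart (g e)}" "path_image (g e) \<inter> K2 = {pathfinish (g e)}"
  proof -
    let ?ends = "{pathstart (g e), pathfinish (g e)}"
    assume *: "pathstart (g e) \<in> K1" "pathfinish (g e) \<notin> K1"
    have "path_image (g e) \<inter> K1 = ?ends \<inter> K1" "path_image (g e) \<inter> K2 = ?ends \<inter> K2"
      using I D by blast+
    moreover have "pathstart (g e) \<notin> K2" "pathfinish (g e) \<in> K2"
      using * I D K(3) by blast+
    ultimately show "path_image (g e) \<inter> K1 = {pathstart (g e)}" "path_image (g e) \<inter> K2 = {pathfinish (g e)}"
      using * by auto
  qed
  then obtain F0 P where "F0 \<in> components (- (K1 \<union> K2))"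
    "path_image (g e) - {pathstart (g e), pathfinish (g e)} \<subseteq> F0"
    "components (- (K1 \<union> K2 \<union> path_image (g e))) = components (- (K1 \<union> K2)) - {F0} \<union> P"
    "card P = 1"
    "P \<inter> components (- (K1 \<union> K2)) = {}" "\<forall>F\<in>P. path_image (g e) \<subseteq> frontier F"
    by (rule components_add_bridge[OF K arc_edge[OF e]])
  then show thesis using that[of F0 P] False by (simp add: D partial_drawing_insert)
qed

text \<open>One class for each connected component of the graph with edge set \<open>E\<close>.\<close>

definition classes :: "'e set \<Rightarrow> complex set set" where
  "classes E = (\<lambda>v. path_component_set (partial_drawing E) (p v)) ` verts M"

text \<open>The map \<open>h\<close> sends an old class to the new class containing it and is onto.
  If the edge joins two different classes, \<open>h\<close> identifies them, so the number
  drops.\<close>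

lemma card_classes_insert:
  assumes e: "e \<in> edges M" and E: "E \<subseteq> edges M - {e}"
  shows "card (classes (insert e E)) +
      (if path_component (partial_drawing E) (pathstart (g e)) (pathfinish (g e)) then 0 else 1)
    \<le> card (classes E)"
proof -
  let ?D = "partial_drawing E" let ?D' = "partial_drawing (insert e E)"
  define h where "h X = (\<Union>x\<in>X. path_component_set ?D' x)" for X
  have pD: "p v \<in> ?D" if "v \<in> verts M" for v using that by (simp add: partial_drawing_def)
  have h: "h (path_component_set ?D (p v)) = path_component_set ?D' (p v)" if v: "v \<in> verts M" for v
  proof -
    have "path_component_set ?D' x = path_component_set ?D' (p v)" if "x \<in> path_component_set ?D (p v)" for x
    proof -
      have "path_component ?D' (p v) x"
        using that path_component_of_subset[of ?D ?D'] by (auto simp: partial_drawing_insert)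
      then show ?thesis by (metis path_component_eq mem_Collect_eq)
    qed
    moreover have "p v \<in> path_component_set ?D (p v)" using pD[OF v] by (simp add: path_component_refl)
    ultimately show ?thesis unfolding h_def by blast
  qed
  have c': "classes (insert e E) = h ` classes E"
    unfolding classes_def image_image using h by (intro image_cong) auto
  have fin: "finite (classes E)" by (simp add: classes_def finite_verts)
  show ?thesis
  proof (cases "path_component ?D (pathstart (g e)) (pathfinish (g e))")
    case True
    then show ?thesis using card_image_le[OF fin, of h] by (simp add: c')
  next
    case False
    obtain u v where uv: "u \<in> verts M" "v \<in> verts M" "pathstart (g e) = p u" "pathfinish (g e) = p v"
    proof -
      have "pathstart (g e) \<in> p ` verts M" "pathfinish (g e) \<in> p ` verts M"
        using edge_ends[OF e] ends_subset[OF e] by blast+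
      then show thesis using that by blast
    qed
    have "path_component ?D' (p u) (p v)"
      unfolding uv(3,4)[symmetric] path_component_def
      using arc_edge[OF e] by (intro exI[of _ "g e"]) (auto simp: arc_imp_path partial_drawing_insert)
    then have "h (path_component_set ?D (p u)) = h (path_component_set ?D (p v))"
      using uv h by (metis path_component_eq mem_Collect_eq)
    moreover have "path_component_set ?D (p u) \<noteq> path_component_set ?D (p v)"
      using False uv pD path_component_refl by (metis mem_Collect_eq)
    ultimately have "\<not> inj_on h (classes E)"
      using uv(1,2) by (auto simp: inj_on_def classes_def)
    then have "card (h ` classes E) < card (classes E)"
      using fin card_image_le[OF fin, of h] eq_card_imp_inj_on[OF fin, of h] by (metis le_neq_implies_less)
    then show ?thesis using False by (simp add: c')
  qed
qed

text \<open>Euler's formula for a graph with \<open>card (classes E)\<close> components, in the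
  direction that bounds the number of faces from below. A chord adds a face; a bridge keeps the
  faces but costs a class.\<close>

lemma partial_euler:
  assumes "finite E" "E \<subseteq> edges M"
  shows "finite (components (- partial_drawing E)) \<and>
    card E + 1 + card (classes E) \<le> card (components (- partial_drawing E)) + card (verts M)"
  using assms
proof (induction E rule: finite_induct)
  case empty
  have fin: "finite (p ` verts M)" using finite_verts by blast
  \<comment> \<open>Finitely many points do not separate the plane, so the edgeless drawing has one
    face.\<close>
  have "connected (- p ` verts M)"
    using connected_open_delete_finite[of "UNIV :: complex set" "p ` verts M"] fin connected_UNIV
    by (simp add: Compl_eq_Diff_UNIV)
  moreover have "- p ` verts M \<noteq> {}"
    using fin infinite_UNIV_char_0[where 'a=complex] by (metis Compl_empty_eq double_compl)
  ultimately have "components (- partial_drawing {}) = {- p ` verts M}"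
    by (simp add: partial_drawing_def components_eq_sing_iff)
  moreover have "card (classes {}) \<le> card (verts M)"
    unfolding classes_def using finite_verts by (rule card_image_le)
  ultimately show ?case by simp
next
  case (insert e E)
  let ?C = "components (- partial_drawing E)"
  have e: "e \<in> edges M" "E \<subseteq> edges M - {e}" using insert by auto
  obtain F0 P where F0: "F0 \<in> ?C" "path_image (g e) - {pathstart (g e), pathfinish (g e)} \<subseteq> F0"
    and C': "components (- partial_drawing (insert e E)) = ?C - {F0} \<union> P"
    and P: "card P = (if path_component (partial_drawing E) (pathstart (g e)) (pathfinish (g e)) then 2 else 1)"
    "P \<inter> ?C = {}" "\<forall>F\<in>P. path_image (g e) \<subseteq> frontier F"
    by (rule components_add_edge[OF e])
  have IH: "finite ?C" "card E + 1 + card (classes E) \<le> card ?C + card (verts M)"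
    using insert by auto
  \<comment> \<open>\<open>card\<close> is 0 on infinite sets, so a positive value gives
    finiteness.\<close>
  have finP: "finite P" using P(1) by (intro card_ge_0_finite) (simp split: if_splits)
  have "card (?C - {F0} \<union> P) = card ?C - 1 + card P"
    using F0 IH finP P(2) by (subst card_Un_disjoint) auto
  moreover have "card ?C > 0" using F0 IH by (auto simp: card_gt_0_iff)
  ultimately have "card (components (- partial_drawing (insert e E))) + 1 = card ?C + card P"
    by (simp add: C')
  then show ?case using IH finP C' card_classes_insert[OF e] P(1) insert.hyps by (auto split: if_splits)
qed

lemma finite_faces: "finite (faces M p g)"
  using partial_euler[of "edges M"] finite_edges by (simp add: faces_eq)

lemma euler:
  assumes "verts M \<noteq> {}"
  shows "card (edges M) + 2 \<le> card (faces M p g) + card (verts M)"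
proof -
  have "card (classes (edges M)) > 0"
    using assms finite_verts by (simp add: classes_def card_gt_0_iff)
  then show ?thesis using partial_euler[of "edges M"] finite_edges by (simp add: faces_eq)
qed

section \<open>Faces at an edge, face degrees and the bound on the number of edges\<close>

definition faces_at :: "'e \<Rightarrow> complex set set" where
  "faces_at e = {F \<in> faces M p g. path_image (g e) \<subseteq> frontier F}"

text \<open>Draw \<open>e\<close> last: the faces at \<open>e\<close> are the pieces into which it
  turns \<open>F0\<close>. Any other face is disjoint from the open set \<open>F0\<close>, hence so
  is its closure, while \<open>F0\<close> contains the inside of \<open>e\<close>.\<close>

lemma faces_at:
  assumes e: "e \<in> edges M"
  shows "card (faces_at e) = 1 \<or> card (faces_at e) = 2"
    and "F \<in> faces M p g \<Longrightarrow> F \<notin> faces_at e \<Longrightarrow> path_image (g e) \<inter> frontier F \<subseteq> p ` verts M"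
proof -
  let ?E = "edges M - {e}" let ?ends = "{pathstart (g e), pathfinish (g e)}"
  obtain F0 P where F0: "F0 \<in> components (- partial_drawing ?E)" "path_image (g e) - ?ends \<subseteq> F0"
    and C: "components (- partial_drawing (insert e ?E)) = components (- partial_drawing ?E) - {F0} \<union> P"
    and P: "card P = (if path_component (partial_drawing ?E) (pathstart (g e)) (pathfinish (g e)) then 2 else 1)"
      "P \<inter> components (- partial_drawing ?E) = {}" "\<forall>F\<in>P. path_image (g e) \<subseteq> frontier F"
    by (rule components_add_edge[OF e order_refl])
  have "open (- partial_drawing ?E)"
    using compact_partial_drawing[of ?E] by (simp add: compact_imp_closed open_Compl)
  then have "open F0" using F0 open_components by blast
  have faces: "faces M p g = components (- partial_drawing ?E) - {F0} \<union> P"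
    using C e by (simp add: faces_eq insert_absorb)
  have other: "path_image (g e) \<inter> frontier F \<subseteq> ?ends" if "F \<in> faces M p g" "F \<notin> P" for F
  proof -
    have "F0 \<inter> F = {}" using that faces components_eq[of F0 _ F] F0 by auto
    then have "F0 \<inter> closure F = {}" using \<open>open F0\<close> open_Int_closure_eq_empty by blast
    then show ?thesis using F0(2) by (auto simp: frontier_def)
  qed
  have "path_image (g e) - ?ends \<noteq> {}"
    using arc_edge[OF e] arc_imp_simple_path nonempty_simple_path_endless by blast
  then have "faces_at e = P" using other P(3) faces unfolding faces_at_def by blast
  then show "card (faces_at e) = 1 \<or> card (faces_at e) = 2" using P(1) by (auto split: if_splits)
  have "?ends \<subseteq> p ` verts M" using edge_ends[OF e] ends_subset[OF e] by (simp add: image_mono)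
  then show "F \<in> faces M p g \<Longrightarrow> F \<notin> faces_at e \<Longrightarrow> path_image (g e) \<inter> frontier F \<subseteq> p ` verts M"
    using other \<open>faces_at e = P\<close> by blast
qed

text \<open>An edge with a single face counts at most 2 there; with two faces, each witnesses that
  the other counts only 1.\<close>

lemma sum_side_incidences_le:
  assumes e: "e \<in> edges M"
  shows "(\<Sum>F\<in>faces M p g. side_incidences M p g F e) \<le> 2"
proof -
  have "(\<Sum>F\<in>faces M p g. side_incidences M p g F e) = (\<Sum>F\<in>faces_at e. side_incidences M p g F e)"
    using finite_faces by (intro sum.mono_neutral_right) (auto simp: faces_at_def side_incidences_def)
  also have "\<dots> \<le> (\<Sum>F\<in>faces_at e. if card (faces_at e) = 1 then 2 else 1)"
  proof (rule sum_mono)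
    fix F assume F: "F \<in> faces_at e"
    show "side_incidences M p g F e \<le> (if card (faces_at e) = 1 then 2 else 1)"
    proof (cases "card (faces_at e) = 1")
      case True then show ?thesis by (simp add: side_incidences_def)
    next
      case False
      then have "faces_at e \<noteq> {F}" by auto
      then obtain F' where "F' \<in> faces_at e" "F' \<noteq> F" using F by blast
      then show ?thesis using False by (auto simp: side_incidences_def faces_at_def)
    qed
  qed
  also have "\<dots> \<le> 2" using faces_at(1)[OF e] by auto
  finally show ?thesis .
qed

text \<open>A boundary with at most one edge is at most an arc plus finitely many points and does
  not separate the plane. Then \<open>F\<close> is the only face and has the sole edge on both
  sides, so its degree is the excluded 2.\<close>

lemma face_degree_ge_3:
  assumes F: "F \<in> faces M p g" and ne: "edges M \<noteq> {}" and deg: "face_degree M p g F \<noteq> 2"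
  shows "face_degree M p g F \<ge> 3"
proof -
  define B where "B = {e \<in> edges M. path_image (g e) \<subseteq> frontier F}"
  have finB: "finite B" using finite_edges by (simp add: B_def)
  have degB: "face_degree M p g F = (\<Sum>e\<in>B. side_incidences M p g F e)"
    unfolding face_degree_def using finite_edges
    by (intro sum.mono_neutral_right) (auto simp: B_def side_incidences_def)
  also have "\<dots> \<ge> (\<Sum>e\<in>B. 1)"
    by (intro sum_mono) (auto simp: B_def side_incidences_def)
  finally have ge: "card B \<le> face_degree M p g F" by simp
  have clD: "closed (partial_drawing (edges M))" using compact_partial_drawing compact_imp_closed by blast
  have frD: "frontier F \<subseteq> partial_drawing (edges M)"
    using frontier_of_components_closed_complement[OF clD] F by (simp add: faces_eq)
  \<comment> \<open>By \<open>faces_at\<close>, an edge not wholly on the frontier meets it only in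
    vertices.\<close>
  have fr: "frontier F \<subseteq> p ` verts M \<union> (\<Union>e\<in>B. path_image (g e))"
  proof
    fix x assume x: "x \<in> frontier F"
    then consider "x \<in> p ` verts M" | e where "e \<in> edges M" "x \<in> path_image (g e)"
      using frD by (auto simp: partial_drawing_def)
    then show "x \<in> p ` verts M \<union> (\<Union>e\<in>B. path_image (g e))"
    proof cases
      case 2
      then show ?thesis using faces_at(2)[OF 2(1) F] x F by (auto simp: faces_at_def B_def)
    qed auto
  qed
  have "card B \<ge> 2"
  proof (rule ccontr)
    assume "\<not> card B \<ge> 2"
    then have "card B = 0 \<or> card B = 1" by linarith
    then have B: "B = {} \<or> (\<exists>e. B = {e})" using finB by (auto simp: card_1_singleton_iff)
    have "connected (- frontier F)"
    proof -
      let ?A = "\<Union>e\<in>B. path_image (g e)"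
      have A: "open (- ?A)" "connected (- ?A)" "?A \<subseteq> frontier F"
      proof -
        have *: "e \<in> edges M \<and> path_image (g e) \<subseteq> frontier F" if "e \<in> B" for e
          using that by (simp add: B_def)
        show "?A \<subseteq> frontier F" using * by blast
        show "open (- ?A)"
          using * finB by (intro open_Compl closed_UN) (auto intro: closed_arc_image arc_edge)
        show "connected (- ?A)"
          using B
        proof
          assume "\<exists>e. B = {e}"
          then obtain e where "B = {e}" by blast
          then show ?thesis using *[of e] by (simp add: arc_edge connected_arc_complement)
        qed (simp add: connected_UNIV)
      qed
      have "frontier F - ?A \<subseteq> p ` verts M" using fr by blast
      then have "finite (frontier F - ?A)" using finite_verts finite_subset by blast
      then have "connected (- ?A - (frontier F - ?A))"
        using connected_open_delete_finite[OF A(1,2), of "frontier F - ?A"] by simp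
      moreover have "- ?A - (frontier F - ?A) = - frontier F" using A by auto
      ultimately show ?thesis by simp
    qed
    have "F \<inter> frontier F = {}" "F \<noteq> {}"
      using F frD in_components_subset in_components_nonempty unfolding faces_eq by blast+
    \<comment> \<open>A connected set that meets \<open>F\<close> but not its frontier stays in
      \<open>F\<close>. Hence every face, being off the drawing, meets \<open>F\<close>.\<close>
    then have "- frontier F \<subseteq> F"
      using connected_Int_frontier[OF \<open>connected (- frontier F)\<close>, of F] by auto
    have one: "F' = F" if F': "F' \<in> faces M p g" for F'
    proof -
      have "F' \<subseteq> - partial_drawing (edges M)" "F' \<noteq> {}"
        using F' in_components_subset in_components_nonempty unfolding faces_eq by blast+
      then have "F' \<inter> F \<noteq> {}" using frD \<open>- frontier F \<subseteq> F\<close> by blast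
      then show ?thesis using F F' components_eq[of F' _ F] unfolding faces_eq by blast
    qed
    obtain e where e: "e \<in> edges M" using ne by blast
    then have "faces_at e \<noteq> {}" using faces_at(1)[OF e] by auto
    then have "e \<in> B" using e one by (auto simp: faces_at_def B_def)
    then have "B = {e}" using B by auto
    moreover have "side_incidences M p g F e = 2"
      using \<open>e \<in> B\<close> one by (auto simp: side_incidences_def B_def)
    ultimately show False using degB deg by simp
  qed
  then show ?thesis using ge deg by linarith
qed

text \<open>With \<open>m\<close> edges, \<open>f\<close> faces and \<open>n\<close> vertices,
  counting incidences gives 3f \<le> 2m. By \<open>euler\<close>, 3m + 6 \<le> 3f + 3n \<le> 2m +
  3n.\<close>

theorem card_edges_le:
  assumes "edges M \<noteq> {}" and "\<forall>F\<in>faces M p g. face_degree M p g F \<noteq> 2"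
  shows "card (edges M) + 6 \<le> 3 * card (verts M)"
proof -
  have "verts M \<noteq> {}" 
  proof -
    obtain e where e: "e \<in> edges M" using assms(1) by blast
    then have "ends M e \<noteq> {}" using card_ends[OF e] by auto
    then show ?thesis using ends_subset[OF e] by blast
  qed
  have "3 * card (faces M p g) \<le> (\<Sum>F\<in>faces M p g. face_degree M p g F)"
    using sum_mono[of "faces M p g" "\<lambda>_. 3" "face_degree M p g"] face_degree_ge_3 assms by simp
  also have "\<dots> = (\<Sum>e\<in>edges M. \<Sum>F\<in>faces M p g. side_incidences M p g F e)"
    unfolding face_degree_def by (rule sum.swap)
  also have "\<dots> \<le> 2 * card (edges M)"
    using sum_mono[of "edges M" _ "\<lambda>_. 2 :: nat"] sum_side_incidences_le by (simp add: mult.commute)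
  finally show ?thesis using euler[OF \<open>verts M \<noteq> {}\<close>] by linarith
qed

end

section \<open>Large induced forests in sparse multigraphs\<close>

text \<open>The probability that, in a random order of a vertex and its \<open>r\<close> red and \<open>b\<close> blue
  neighbours, the vertex is preceded by no red and by at most one blue neighbour.\<close>

definition weight :: "nat \<Rightarrow> nat \<Rightarrow> real" where
  "weight r b = (if r + b = 0 then 1 else real (r + 2 * b) / real ((r + b) * (r + b + 1)))"

lemma weight_pos:
  assumes "r + b > 0"
  shows "weight r b = (real r + 2 * real b) / ((real r + real b) * (real r + real b + 1))"
  using assms by (auto simp: weight_def algebra_simps)

text \<open>Condition on which of the \<open>r + b + 1\<close> vertices comes last. A neighbour that
  is last can be ignored; if the vertex itself is last, all neighbours precede it. Truncated
  subtraction is harmless, as its factor is then 0.\<close>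

lemma weight_rec:
  "real r * weight (r - 1) b + real b * weight r (b - 1) + (if r = 0 \<and> b \<le> 1 then 1 else 0) =
     real (r + b + 1) * weight r b"
proof -
  consider "r + b = 0" | "r + b = 1" | "r + b \<ge> 2" by linarith
  then show ?thesis
  proof cases
    case 1 then show ?thesis by (simp add: weight_def)
  next
    case 2
    then have "(r = 0 \<and> b = 1) \<or> (r = 1 \<and> b = 0)" by auto
    then show ?thesis by (auto simp: weight_def)
  next
    case 3
    define x where "x = real r" define y where "y = real b"
    have xy: "x + y \<ge> 2" using 3 by (simp add: x_def y_def flip: of_nat_add)
    have r: "real r * weight (r - 1) b = x * (x - 1 + 2 * y) / ((x + y - 1) * (x + y))"
    proof (cases r)
      case (Suc k)
      then have "x - 1 = real k" "k + b > 0" using 3 by (auto simp: x_def)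
      then have "weight k b = (x - 1 + 2 * y) / ((x - 1 + y) * (x - 1 + y + 1))"
        using weight_pos[of k b] by (simp add: y_def)
      moreover have "(x - 1 + y) * (x - 1 + y + 1) = (x + y - 1) * (x + y)" by (simp add: algebra_simps)
      ultimately have "weight k b = (x - 1 + 2 * y) / ((x + y - 1) * (x + y))" by simp
      then show ?thesis using Suc by (simp add: x_def)
    qed (simp add: x_def)
    have b: "real b * weight r (b - 1) = y * (x + 2 * y - 2) / ((x + y - 1) * (x + y))"
    proof (cases b)
      case (Suc k)
      then have "y - 1 = real k" "r + k > 0" using 3 by (auto simp: y_def)
      then have "weight r k = (x + 2 * (y - 1)) / ((x + (y - 1)) * (x + (y - 1) + 1))"
        using weight_pos[of r k] by (simp add: x_def)
      moreover have "(x + (y - 1)) * (x + (y - 1) + 1) = (x + y - 1) * (x + y)"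
        "x + 2 * (y - 1) = x + 2 * y - 2" by (simp_all add: algebra_simps)
      ultimately have "weight r k = (x + 2 * y - 2) / ((x + y - 1) * (x + y))" by (simp only:)
      then show ?thesis using Suc by (simp add: y_def)
    qed (simp add: y_def)
    have "real r * weight (r - 1) b + real b * weight r (b - 1) =
        (x * (x - 1 + 2 * y) + y * (x + 2 * y - 2)) / ((x + y - 1) * (x + y))"
      unfolding r b by (simp add: add_divide_distrib)
    also have "x * (x - 1 + 2 * y) + y * (x + 2 * y - 2) = (x + y - 1) * (x + 2 * y)"
      by (simp add: algebra_simps)
    also have "\<dots> / ((x + y - 1) * (x + y)) = (x + 2 * y) / (x + y)"
      using xy by simp
    also have "\<dots> = (x + y + 1) * ((x + 2 * y) / ((x + y) * (x + y + 1)))"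
      using xy by simp
    also have "\<dots> = real (r + b + 1) * weight r b"
    proof -
      have "0 < r + b" using 3 by linarith
      then show ?thesis using weight_pos[of r b] by (simp only: x_def y_def of_nat_add of_nat_1)
    qed
    finally show ?thesis using 3 by auto
  qed
qed

text \<open>The term \<open>2 * r + b\<close> is a lower bound for a degree, so 1/24 for each edge
  end becomes 1/12 for each edge. Equality holds for \<open>b = 0\<close> and \<open>r\<close> equal
  to 2 or 3.\<close>

lemma weight_ge: "weight r b \<ge> 1 / 2 - real (2 * r + b) / 24"
proof (cases "r + b = 0")
  case False
  define d where "d = real (r + b)" define y where "y = real b"
  have d: "d \<ge> 1" "0 \<le> y" "y \<le> d" using False by (auto simp: d_def y_def)
  \<comment> \<open>Here it matters that \<open>d\<close> is an integer: none lies strictly between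
    2 and 3.\<close>
  have int: "(d - 2) * (d - 3) \<ge> 0"
  proof -
    have "r + b \<le> 2 \<or> r + b \<ge> 3" by linarith
    then show ?thesis
    proof
      assume "r + b \<le> 2"
      then have "d \<le> 2" by (simp add: d_def)
      then show ?thesis by (intro mult_nonpos_nonpos) auto
    next
      assume "3 \<le> r + b"
      then have "3 \<le> d" by (simp add: d_def)
      then show ?thesis by (intro mult_nonneg_nonneg) auto
    qed
  qed
  have "(12 - 2 * d + y) * (d * (d + 1)) \<le> 24 * (d + y)"
  proof -
    have p: "d * (d * d - 11 * d + 36) \<ge> 0" (is "?p \<ge> 0")
    proof -
      have "d * d - 11 * d + 36 = (d - 11 / 2)\<^sup>2 + 23 / 4" by (simp add: power2_eq_square algebra_simps)
      also have "\<dots> \<ge> 0" by simp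
      finally show ?thesis using d by simp
    qed
    have q: "2 * (d * ((d - 2) * (d - 3))) \<ge> 0" (is "?q \<ge> 0") using d int by simp
    \<comment> \<open>The slack after clearing denominators. It is affine in \<open>y\<close>, so it
      is interpolated between its values \<open>?q\<close> at \<open>y = 0\<close> and
      \<open>?p\<close> at \<open>y = d\<close>.\<close>
    define z where "z = 24 * (d + y) - (12 - 2 * d + y) * (d * (d + 1))"
    have "d * z = (d - y) * ?q + y * ?p"
      by (simp add: z_def algebra_simps)
    also have "\<dots> \<ge> 0"
      using d by (intro add_nonneg_nonneg mult_nonneg_nonneg[OF _ q] mult_nonneg_nonneg[OF _ p]) auto
    finally have "z \<ge> 0" using d by (simp add: zero_le_mult_iff)
    then show ?thesis by (simp add: z_def)
  qed
  then have "(12 - 2 * d + y) / 24 \<le> (d + y) / (d * (d + 1))"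
    using d by (subst pos_le_divide_eq) (auto simp: mult.commute)
  moreover have "1 / 2 - real (2 * r + b) / 24 = (12 - 2 * d + y) / 24"
    by (simp add: d_def y_def field_simps)
  \<comment> \<open>The chance 1/(d + 1) of coming first plus the chance y/(d(d + 1)) of coming
    second after a blue neighbour.\<close>
  moreover have "weight r b = (d + y) / (d * (d + 1))"
    using False weight_pos[of r b] by (simp add: d_def y_def algebra_simps)
  ultimately show ?thesis by (simp only:)
qed (simp add: weight_def)

lemma card_ordered_pairs_le:
  assumes "card A = 2"
  shows "card {x \<in> B. A = {snd x, fst x}} \<le> 2"
proof -
  obtain a b where ab: "A = {a, b}" using assms by (meson card_2_iff)
  have "{x \<in> B. A = {snd x, fst x}} \<subseteq> set [(a, b), (b, a)]"
    unfolding ab by (auto simp: doubleton_eq_iff)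
  then have "card {x \<in> B. A = {snd x, fst x}} \<le> card (set [(a, b), (b, a)])"
    by (intro card_mono) auto
  also have "\<dots> \<le> length [(a, b), (b, a)]" by (rule card_length)
  finally show ?thesis by simp
qed

section \<open>Averaging over vertex orders for a red and a blue relation\<close>

locale two_relations =
  fixes red blue :: "'v \<Rightarrow> 'v \<Rightarrow> bool"
  assumes disjoint: "\<not> (red u v \<and> blue u v)"
    and irrefl: "\<not> red v v" "\<not> blue v v"
begin

definition reds :: "'v set \<Rightarrow> 'v \<Rightarrow> nat" where "reds S u = card {v \<in> S. red v u}"
definition blues :: "'v set \<Rightarrow> 'v \<Rightarrow> nat" where "blues S u = card {v \<in> S. blue v u}"

text \<open>Red will mean joined by parallel edges and blue joined by one edge; under this condition
  adding \<open>v\<close> to \<open>S\<close> closes no cycle through \<open>v\<close>.\<close>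

abbreviation leaf :: "'v set \<Rightarrow> 'v \<Rightarrow> bool" where
  "leaf S v \<equiv> reds S v = 0 \<and> blues S v \<le> 1"

text \<open>The expected number of kept vertices in a uniformly random order of \<open>S\<close>, by
  linearity of expectation.\<close>

definition total :: "'v set \<Rightarrow> real" where "total S = (\<Sum>u\<in>S. weight (reds S u) (blues S u))"

inductive peelable :: "'v set \<Rightarrow> bool" where
  empty: "peelable {}"
| insert: "peelable T \<Longrightarrow> v \<notin> T \<Longrightarrow> leaf T v \<Longrightarrow> peelable (insert v T)"

text \<open>This is \<open>weight_rec\<close> at \<open>u\<close>, with the vertices of
  \<open>N\<close>, which are neither \<open>u\<close> nor its neighbours, added: deleting one of
  them leaves the weight of \<open>u\<close> unchanged.\<close>

lemma sum_weight_delete: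
  assumes S: "finite S" "u \<in> S"
  shows "(\<Sum>v\<in>S - {u}. weight (reds (S - {v}) u) (blues (S - {v}) u)) + (if leaf S u then 1 else 0) =
    real (card S) * weight (reds S u) (blues S u)"
proof -
  let ?r = "reds S u" let ?b = "blues S u"
  let ?R = "{v \<in> S. red v u}" let ?B = "{v \<in> S. blue v u}"
  define N where "N = S - {u} - ?R - ?B"
  let ?h = "\<lambda>v. weight (reds (S - {v}) u) (blues (S - {v}) u)"
  have fin: "finite ?R" "finite ?B" "finite N" using S by (auto simp: N_def)
  have eq: "S - {u} = ?R \<union> (?B \<union> N)" using irrefl by (auto simp: N_def)
  have "(\<Sum>v\<in>S - {u}. ?h v) = (\<Sum>v\<in>?R. ?h v) + ((\<Sum>v\<in>?B. ?h v) + (\<Sum>v\<in>N. ?h v))"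
  proof -
    have "?R \<inter> (?B \<union> N) = {}" "?B \<inter> N = {}" using disjoint by (auto simp: N_def)
    then show ?thesis
      unfolding eq using fin sum.union_disjoint[of ?R "?B \<union> N" ?h] sum.union_disjoint[of ?B N ?h]
      by (simp only: finite_Un)
  qed
  also have "(\<Sum>v\<in>?R. ?h v) = real ?r * weight (?r - 1) ?b"
  proof -
    have "?h v = weight (?r - 1) ?b" if "v \<in> ?R" for v
    proof -
      have "{w \<in> S - {v}. red w u} = ?R - {v}" "{w \<in> S - {v}. blue w u} = ?B"
        using that disjoint by auto
      then show ?thesis using that fin by (simp add: reds_def blues_def)
    qed
    then show ?thesis by (simp add: reds_def)
  qed
  also have "(\<Sum>v\<in>?B. ?h v) = real ?b * weight ?r (?b - 1)"
  proof -
    have "?h v = weight ?r (?b - 1)" if "v \<in> ?B" for v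
    proof -
      have "{w \<in> S - {v}. red w u} = ?R" "{w \<in> S - {v}. blue w u} = ?B - {v}"
        using that disjoint by auto
      then show ?thesis using that fin by (simp add: reds_def blues_def)
    qed
    then show ?thesis by (simp add: blues_def)
  qed
  also have "(\<Sum>v\<in>N. ?h v) = real (card N) * weight ?r ?b"
  proof -
    have "?h v = weight ?r ?b" if "v \<in> N" for v
    proof -
      have "{w \<in> S - {v}. red w u} = ?R" "{w \<in> S - {v}. blue w u} = ?B"
        using that by (auto simp: N_def)
      then show ?thesis by (simp add: reds_def blues_def)
    qed
    then show ?thesis by simp
  qed
  moreover have "card S = card N + (?r + ?b + 1)"
  proof -
    have "card (S - {u}) = card ?R + (card ?B + card N)"
    proof -
      have "?R \<inter> (?B \<union> N) = {}" "?B \<inter> N = {}" using disjoint by (auto simp: N_def)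
      then show ?thesis
        unfolding eq using fin card_Un_disjoint[of ?R "?B \<union> N"] card_Un_disjoint[of ?B N]
        by (simp only: finite_Un)
    qed
    moreover have "card S = card (S - {u}) + 1" using S card_Suc_Diff1 by fastforce
    ultimately show ?thesis by (simp add: reds_def blues_def)
  qed
  ultimately show ?thesis using weight_rec[of ?r ?b] by (simp add: distrib_right)
qed

text \<open>Averaging over the vertex that comes last in the random order.\<close>

lemma sum_total_delete:
  assumes "finite S"
  shows "(\<Sum>v\<in>S. total (S - {v}) + (if leaf S v then 1 else 0)) = real (card S) * total S"
proof -
  have "(\<Sum>v\<in>S. total (S - {v})) =
      (\<Sum>v\<in>S. \<Sum>u | u \<in> S \<and> u \<noteq> v. weight (reds (S - {v}) u) (blues (S - {v}) u))"
    by (simp add: total_def set_diff_eq)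
  also have "\<dots> = (\<Sum>u\<in>S. \<Sum>v | v \<in> S \<and> u \<noteq> v. weight (reds (S - {v}) u) (blues (S - {v}) u))"
    using assms by (intro sum.swap_restrict)
  also have "\<dots> = (\<Sum>u\<in>S. \<Sum>v\<in>S - {u}. weight (reds (S - {v}) u) (blues (S - {v}) u))"
    by (intro sum.cong) auto
  finally have "(\<Sum>v\<in>S. total (S - {v}) + (if leaf S v then 1 else 0)) =
      (\<Sum>u\<in>S. (\<Sum>v\<in>S - {u}. weight (reds (S - {v}) u) (blues (S - {v}) u)) + (if leaf S u then 1 else 0))"
    by (simp only: sum.distrib)
  also have "\<dots> = (\<Sum>u\<in>S. real (card S) * weight (reds S u) (blues S u))"
    using sum_weight_delete[OF assms] by (intro sum.cong) auto
  finally show ?thesis by (simp add: total_def sum_distrib_left)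
qed

text \<open>Some choice of the last vertex is at least as good as the average. Induction handles the
  remaining vertices, and the last one is added if it is a leaf.\<close>

lemma exists_peelable:
  "finite S \<Longrightarrow> \<exists>T\<subseteq>S. peelable T \<and> total S \<le> real (card T)"
proof (induction "card S" arbitrary: S)
  case 0
  then show ?case using peelable.empty by (intro exI[of _ "{}"]) (simp add: total_def)
next
  case (Suc n)
  let ?t = "\<lambda>v. total (S - {v}) + (if leaf S v then 1 else 0)"
  have "\<exists>v\<in>S. total S \<le> ?t v"
  proof (rule ccontr)
    assume "\<not> ?thesis"
    then have "sum ?t S < (\<Sum>v\<in>S. total S)"
      using Suc.hyps(2) Suc.prems by (intro sum_strict_mono) (auto simp only: not_le bex_simps card.empty nat.distinct)
    then show False using sum_total_delete[OF Suc.prems] by simp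
  qed
  then obtain v where v: "v \<in> S" "total S \<le> ?t v" by blast
  have "n = card (S - {v})" using v Suc by simp
  then obtain T where T: "T \<subseteq> S - {v}" "peelable T" "total (S - {v}) \<le> real (card T)"
    using Suc.hyps(1)[of "S - {v}"] Suc.prems by auto
  show ?case
  proof (cases "leaf S v")
    case True
    have "finite T" using T Suc.prems finite_subset by blast
    \<comment> \<open>Being a leaf passes from \<open>S\<close> to its subset \<open>T\<close>,
      since neighbour counts can only shrink.\<close>
    have "card {w \<in> T. R w v} \<le> card {w \<in> S. R w v}" for R
      using T(1) Suc.prems by (intro card_mono) auto
    then have "reds T v \<le> reds S v" "blues T v \<le> blues S v" by (simp_all add: reds_def blues_def)
    then have "leaf T v" using True by linarith
    then have "peelable (insert v T)" using T by (intro peelable.insert) auto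
    moreover have "total S \<le> real (card (insert v T))"
      using v(2) True T \<open>finite T\<close> by (subst card_insert_disjoint) auto
    ultimately show ?thesis using T v(1) by (intro exI[of _ "insert v T"]) auto
  next
    case False
    then show ?thesis using v(2) T by (intro exI[of _ T]) auto
  qed
qed

end

section \<open>From peelable sets to induced forests, and the degree sum\<close>

context multigraph
begin

definition edge_count :: "'v \<Rightarrow> 'v \<Rightarrow> nat" where
  "edge_count u v = card {e \<in> edges M. ends M e = {u, v}}"

lemma edge_count_irrefl: "edge_count v v = 0"
proof -
  have "ends M e \<noteq> {v, v}" if "e \<in> edges M" for e
    using card_ends[OF that] by auto
  then have *: "{e \<in> edges M. ends M e = {v, v}} = {}" by blast
  show ?thesis unfolding edge_count_def * by simp
qed

lemma edge_count_pos:
  assumes "edge_count u v \<noteq> 0"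
  shows "u \<in> verts M"
proof -
  have "{e \<in> edges M. ends M e = {u, v}} \<noteq> {}"
  proof
    assume *: "{e \<in> edges M. ends M e = {u, v}} = {}"
    show False using assms unfolding edge_count_def * by simp
  qed
  then obtain e where "e \<in> edges M" "ends M e = {u, v}" by blast
  then show ?thesis using ends_subset[of e] by simp
qed

sublocale simple: two_relations "\<lambda>u v. 2 \<le> edge_count u v" "\<lambda>u v. edge_count u v = 1"
  by unfold_locales (auto simp: edge_count_irrefl)

lemma edge_count_ge:
  assumes "E \<subseteq> {e \<in> edges M. ends M e = {u, v}}"
  shows "card E \<le> edge_count u v"
  unfolding edge_count_def using assms finite_edges by (intro card_mono) auto

text \<open>A cycle through the new vertex \<open>v\<close> has two distinct edges at
  \<open>v\<close>. Their other ends are blue neighbours in \<open>T\<close>, hence equal; so the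
  two edges are parallel and the neighbour is red, a contradiction.\<close>

lemma peelable_forest:
  "simple.peelable T \<Longrightarrow> forest (induced M T)"
proof (induction rule: simple.peelable.induct)
  case empty
  show ?case by (auto simp: forest_def is_cycle_def induced_def)
next
  case (insert T v)
  have red: "\<not> 2 \<le> edge_count x v" if "x \<in> T" for x
  proof
    assume "2 \<le> edge_count x v"
    \<comment> \<open>Without finiteness, a cardinality of 0 would not mean that there is no red
      neighbour. Neighbours of \<open>v\<close> lie in \<open>verts M\<close>, even if
      \<open>T\<close> does not.\<close>
    moreover have "finite {w \<in> T. 2 \<le> edge_count w v}"
      by (rule finite_subset[OF _ finite_verts]) (auto intro!: edge_count_pos[of _ v])
    ultimately show False using insert.hyps(3) that by (auto simp: simple.reds_def)
  qed
  have blue: "x = y" if "x \<in> T" "y \<in> T" "edge_count x v = 1" "edge_count y v = 1" for x y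
  proof -
    have "finite {w \<in> T. edge_count w v = 1}"
      by (rule finite_subset[OF _ finite_verts]) (auto intro!: edge_count_pos[of _ v])
    moreover have "card {w \<in> T. edge_count w v = 1} \<le> 1"
      using insert.hyps(3) unfolding simple.blues_def by blast
    ultimately have "\<forall>a\<in>{w \<in> T. edge_count w v = 1}. \<forall>b\<in>{w \<in> T. edge_count w v = 1}. a = b"
      using card_le_Suc0_iff_eq[of "{w \<in> T. edge_count w v = 1}"] by (simp only: One_nat_def)
    then show ?thesis using that by blast
  qed
  show ?case
    unfolding forest_def
  proof
    assume "\<exists>vs es. is_cycle (induced M (insert v T)) vs es"
    then obtain vs es where c: "is_cycle (induced M (insert v T)) vs es" by blast
    define n where "n = length vs"
    have n: "2 \<le> n" "length es = n" "distinct vs" "distinct es" "set vs \<subseteq> insert v T" "set es \<subseteq> edges M"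
      and ends: "\<And>i. i < n \<Longrightarrow> ends M (es ! i) = {vs ! i, vs ! (Suc i mod n)}"
      using c by (auto simp: is_cycle_def induced_def n_def)
    have nth: "vs ! i \<in> set vs" if "i < n" for i using that by (simp add: n_def)
    show False
    proof (cases "v \<in> set vs")
      case False
      then have "set vs \<subseteq> T" using n by blast
      moreover have "set es \<subseteq> {e \<in> edges M. ends M e \<subseteq> T}"
      proof
        fix e assume e: "e \<in> set es"
        then obtain i where i: "i < n" "e = es ! i" using n(2) by (metis in_set_conv_nth)
        have "Suc i mod n < n" using n by simp
        then have "ends M e \<subseteq> set vs" using ends[OF i(1)] i nth by auto
        then show "e \<in> {e \<in> edges M. ends M e \<subseteq> T}" using e n \<open>set vs \<subseteq> T\<close> by auto
      qed
      ultimately have "is_cycle (induced M T) vs es"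
        using c by (auto simp: is_cycle_def induced_def)
      then show False using insert.IH by (auto simp: forest_def)
    next
      case True
      then obtain j where j: "j < n" "vs ! j = v" by (metis in_set_conv_nth n_def)
      \<comment> \<open>Cyclic predecessor and successor of \<open>j\<close>; the edges at positions
        \<open>k\<close> and \<open>j\<close> are those at \<open>v\<close>. In a 2-cycle
        \<open>k = l\<close>, but the edges still differ.\<close>
      define k where "k = (if j = 0 then n - 1 else j - 1)"
      define l where "l = Suc j mod n"
      have k: "k < n" "k \<noteq> j" "Suc k mod n = j" using j n(1) by (auto simp: k_def)
      have l: "l < n" "l \<noteq> j" using j n(1) by (auto simp: l_def mod_Suc)
      have dv: "vs ! i \<in> T" if "i < n" "i \<noteq> j" for i
        using that j n(3,5) nth[OF that(1)] by (metis insertE n_def nth_eq_iff_index_eq subsetD)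
      have e: "es ! j \<in> edges M" "es ! k \<in> edges M" "es ! j \<noteq> es ! k"
        using n(2,4,6) j(1) k(1,2) by (auto simp: nth_eq_iff_index_eq)
      have ek: "ends M (es ! k) = {vs ! k, v}" using ends[OF k(1)] k j by simp
      have ej: "ends M (es ! j) = {vs ! l, v}" using ends[OF j(1)] j by (auto simp: l_def)
      have "1 \<le> edge_count (vs ! k) v" "1 \<le> edge_count (vs ! l) v"
        using edge_count_ge[of "{es ! k}" "vs ! k" v] edge_count_ge[of "{es ! j}" "vs ! l" v] e ek ej by auto
      moreover have "\<not> 2 \<le> edge_count (vs ! k) v" "\<not> 2 \<le> edge_count (vs ! l) v"
        using red dv k l by blast+
      ultimately have "edge_count (vs ! k) v = 1" "edge_count (vs ! l) v = 1" by linarith+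
      then have "vs ! k = vs ! l" using blue dv k l by blast
      then have "2 \<le> edge_count (vs ! k) v"
        using edge_count_ge[of "{es ! j, es ! k}" "vs ! k" v] e ek ej by auto
      then show False using red dv k by blast
    qed
  qed
qed

text \<open>A red pair carries at least two edges and a blue pair exactly one, so this is the
  handshake count: each edge belongs to two ordered pairs.\<close>

lemma sum_degrees_le:
  "(\<Sum>u\<in>verts M. 2 * simple.reds (verts M) u + simple.blues (verts M) u) \<le> 2 * card (edges M)"
proof -
  let ?V = "verts M"
  have card_sum: "card {v \<in> ?V. P v} = (\<Sum>v\<in>?V. if P v then 1 else 0)" for P
    using finite_verts by (simp add: sum.If_cases Int_def)
  have "(\<Sum>u\<in>?V. 2 * simple.reds ?V u + simple.blues ?V u) =
      (\<Sum>u\<in>?V. \<Sum>v\<in>?V. 2 * (if 2 \<le> edge_count v u then 1 else 0) + (if edge_count v u = 1 then 1 else 0))"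
    unfolding simple.reds_def simple.blues_def card_sum by (simp only: sum.distrib sum_distrib_left)
  also have "\<dots> \<le> (\<Sum>u\<in>?V. \<Sum>v\<in>?V. edge_count v u)"
    by (intro sum_mono) auto
  also have "\<dots> = (\<Sum>x\<in>?V \<times> ?V. card {e \<in> edges M. ends M e = {snd x, fst x}})"
    by (simp add: sum.cartesian_product edge_count_def case_prod_unfold)
  also have "\<dots> = (\<Sum>x\<in>?V \<times> ?V. \<Sum>e | e \<in> edges M \<and> ends M e = {snd x, fst x}. 1)"
    by simp
  also have "\<dots> = (\<Sum>e\<in>edges M. \<Sum>x | x \<in> ?V \<times> ?V \<and> ends M e = {snd x, fst x}. 1)"
    using finite_verts finite_edges by (intro sum.swap_restrict) auto
  also have "\<dots> \<le> (\<Sum>e\<in>edges M. 2)"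
  proof (rule sum_mono)
    fix e assume "e \<in> edges M"
    then show "(\<Sum>x | x \<in> ?V \<times> ?V \<and> ends M e = {snd x, fst x}. 1) \<le> (2::nat)"
      using card_ordered_pairs_le[OF card_ends, of e "?V \<times> ?V"] by (simp only: card_eq_sum)
  qed
  finally show ?thesis by (simp add: mult.commute)
qed

lemma card_le_max_induced_forest:
  assumes "S \<subseteq> verts M" "forest (induced M S)"
  shows "card S \<le> max_induced_forest M"
  unfolding max_induced_forest_def
proof (rule Max_ge)
  show "finite {card S |S. S \<subseteq> verts M \<and> forest (induced M S)}"
    using finite_verts by simp
qed (use assms in blast)

theorem max_induced_forest_ge:
  "real (max_induced_forest M) \<ge> real (card (verts M)) / 2 - real (card (edges M)) / 12"
proof -
  let ?V = "verts M"
  obtain T where T: "T \<subseteq> ?V" "simple.peelable T" "simple.total ?V \<le> real (card T)"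
    using simple.exists_peelable[OF finite_verts] by blast
  have "real (card ?V) / 2 - real (\<Sum>u\<in>?V. 2 * simple.reds ?V u + simple.blues ?V u) / 24 =
      (\<Sum>u\<in>?V. 1 / 2 - real (2 * simple.reds ?V u + simple.blues ?V u) / 24)"
    by (simp add: sum_subtractf sum_divide_distrib)
  also have "\<dots> \<le> simple.total ?V"
    unfolding simple.total_def by (intro sum_mono weight_ge)
  also have "\<dots> \<le> real (max_induced_forest M)"
    using T card_le_max_induced_forest[OF T(1) peelable_forest[OF T(2)]] by linarith
  finally have "real (card ?V) / 2 - real (\<Sum>u\<in>?V. 2 * simple.reds ?V u + simple.blues ?V u) / 24
    \<le> real (max_induced_forest M)" .
  moreover have "real (\<Sum>u\<in>?V. 2 * simple.reds ?V u + simple.blues ?V u) \<le> real (2 * card (edges M))"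
    using sum_degrees_le by (rule of_nat_mono)
  ultimately show ?thesis by simp
qed

end

section \<open>Combining the forest bound with the edge bound\<close>

theorem theorem15:
  fixes M :: "('v, 'e) pre_multigraph"
  assumes "multigraph M"
    and "card (verts M) \<ge> 1"
    and "\<exists>p g. plane_embedding M p g \<and> (\<forall>F\<in>faces M p g. face_degree M p g F \<noteq> 2)"
  shows "real (max_induced_forest M) \<ge> real (card (verts M)) / 4 + 3 / 10"
proof -
  interpret multigraph M by fact
  let ?n = "card (verts M)" let ?m = "card (edges M)" let ?a = "max_induced_forest M"
  have a: "real ?a \<ge> real ?n / 2 - real ?m / 12" by (rule max_induced_forest_ge)
  show ?thesis
  proof (cases "edges M = {}")
    \<comment> \<open>The bound m \<le> 3n - 6 needs an edge. Here a \<ge> n/2, so integrality gives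
      a \<ge> 1, which settles n = 1; for n \<ge> 2, n/2 \<ge> n/4 + 1/2.\<close>
    case True
    then have "real ?a \<ge> real ?n / 2" using a by simp
    moreover from this have "?a \<ge> 1" using assms(2) by (cases ?a) auto
    moreover have "?n = 1 \<or> ?n \<ge> 2" using assms(2) by linarith
    ultimately show ?thesis by auto
  next
    case False
    obtain p g where pg: "plane_embedding M p g" "\<forall>F\<in>faces M p g. face_degree M p g F \<noteq> 2"
      using assms(3) by blast
    interpret plane_multigraph M p g by unfold_locales (rule pg(1))
    have "?m + 6 \<le> 3 * ?n" using card_edges_le[OF False pg(2)] .
    then have "real ?m + 6 \<le> 3 * real ?n" by linarith
    then show ?thesis using a by linarith
  qed
qed

end
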